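(* Let $p$ be a prime integer, let $R$ be a finite $p$-ring and let $\{\mathfrak{m}_1,\dots,\mathfrak{m}_n\}$ be the set of all maximal ideals of $R$ (with $\mathfrak{m}_1,\dots,\mathfrak{m}_n$ distinct). Let $f(x)=\sum_{i=0}^k a_i x^i\in R[x]$ be a polynomial with $(f(x))\neq R[x]$, and for each $j\in\{1,\dots,n\}$ let $f_j(x)=\sum_{i=0}^k (a_i+\mathfrak{m}_j)x^i\in (R/\mathfrak{m}_j)[x]$ be the reduction of $f(x)$ modulo $\mathfrak{m}_j$. Then $R[x]/(f(x))$ is a $p$-ring if and only if for each $j\in\{1,\dots,n\}$, $f_j(x)$ splits with distinct roots in the field $R/\mathfrak{m}_j$.
   Context: All rings are commutative with identity element $\neq 0$. For a prime integer $p$, a ring $R$ is called a $p$-ring if $x^p=x$ and $px=0$ for each $x\in R$. A polynomial $g(x)$ over a field $K$ is said to split with distinct roots in $K$ if $g\neq 0$ and $g$ has exactly $\deg g$ distinct roots in $K$ (equivalently, $g$ is a nonzero constant times a possibly empty product of pairwise distinct monic linear factors over $K$). *)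

theory Defs
  imports "HOL-Algebra.UnivPoly" "HOL-Algebra.QuotRing" "HOL-Computational_Algebra.Primes"
begin

text \<open>Rings are commutative with \<open>1 \<noteq> 0\<close>, so the trivial ring is not a \<open>p\<close>-ring.\<close>

locale p_ring = cring R for p :: nat and R (structure) +
  assumes one_neq_zero: "\<one> \<noteq> \<zero>"
    and pow_p: "x \<in> carrier R \<Longrightarrow> x [^] p = x"
    and add_pow_p: "x \<in> carrier R \<Longrightarrow> [p] \<cdot> x = \<zero>"

definition reduce_poly ::
    "('a, 'm) ring_scheme \<Rightarrow> 'a set \<Rightarrow> (nat \<Rightarrow> 'a) \<Rightarrow> (nat \<Rightarrow> 'a set)"
  where "reduce_poly R I f = (\<lambda>i. I +>\<^bsub>R\<^esub> coeff (UP R) f i)"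

definition poly_roots :: "('a, 'm) ring_scheme \<Rightarrow> (nat \<Rightarrow> 'a) \<Rightarrow> 'a set"
  where "poly_roots K g = {x \<in> carrier K. UnivPoly.eval K K id x g = \<zero>\<^bsub>K\<^esub>}"

text \<open>Over a field \<open>K\<close> the root set of \<open>g \<noteq> 0\<close> is finite, so \<open>card\<close> is its true cardinality;
  for a nonzero constant both sides of the equation are \<open>0\<close>.\<close>

definition splits_distinct :: "('a, 'm) ring_scheme \<Rightarrow> (nat \<Rightarrow> 'a) \<Rightarrow> bool"
  where "splits_distinct K g \<longleftrightarrow>
    g \<noteq> \<zero>\<^bsub>UP K\<^esub> \<and> card (poly_roots K g) = deg K g"

end

theory Submission
  imports Defs "HOL-Algebra.Multiplicative_Group"
begin

text \<open>
  Since \<open>p = 0\<close> in \<open>R\<close> and \<open>(f)\<close> is proper, \<open>R[x]/(f)\<close> is a \<open>p\<close>-ring exactly when \<open>f\<close> divides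
  \<open>g\<^sup>p - g\<close> for every \<open>g \<in> R[x]\<close> (\<open>p_ring_Quot_iff\<close>).  This condition is treated first over the
  residue fields and then carried back to \<open>R\<close>.

  A residue field \<open>K\<close> is a \<open>p\<close>-ring and a field, so it has at least \<open>p\<close> elements, all of them roots
  of \<open>x\<^sup>p - x\<close>.  If \<open>f h = x\<^sup>p - x\<close> over \<open>K\<close>, then the roots of \<open>f\<close> and \<open>h\<close> together exhaust \<open>K\<close>
  although there are at most \<open>deg f + deg h = p\<close> of them; equality is forced, so \<open>f\<close> has \<open>deg f\<close>
  roots.  Conversely, if \<open>f\<close> has \<open>deg f\<close> roots, it divides every polynomial vanishing at
  these roots, because the remainder of the division has too small a degree to vanish there without
  being zero; and \<open>g\<^sup>p - g\<close> vanishes on all of \<open>K\<close>.  This is \<open>splits_distinct_iff_dvd_pow_p_diff\<close>.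

  Divisibility by \<open>f\<close> over \<open>R\<close> passes to the residue fields by reducing the quotient.  It can also be
  tested there (\<open>dvd_locally_imp_dvd\<close>).  The elements \<open>r\<close> with \<open>f\<close> dividing \<open>r g\<close> form an ideal,
  and it suffices that this ideal lies in no maximal ideal \<open>M\<close>.  If \<open>f\<close> divides \<open>g\<close> modulo \<open>M\<close>, then
  \<open>g - u f\<close> has all coefficients in \<open>M\<close> for some \<open>u\<close>.  In a \<open>p\<close>-ring, \<open>c \<in> M\<close> is annihilated by
  \<open>1 - c\<^sup>p\<^sup>-\<^sup>1\<close>, which is not in \<open>M\<close>, so the product of these factors over the coefficients is an
  element \<open>e \<notin> M\<close> with \<open>e g = e u f\<close>.
\<close>

section \<open>Applying a ring homomorphism to the coefficients of a polynomial\<close>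

definition coeff_map :: "('a, 'm) ring_scheme \<Rightarrow> ('a \<Rightarrow> 'b) \<Rightarrow> (nat \<Rightarrow> 'a) \<Rightarrow> (nat \<Rightarrow> 'b)"
  where "coeff_map R h f = (\<lambda>i. h (coeff (UP R) f i))"

context ring_hom_cring
begin

lemma hom_cgenideal:
  assumes "f \<in> carrier R" "g \<in> PIdl\<^bsub>R\<^esub> f"
  shows "h g \<in> PIdl\<^bsub>S\<^esub> (h f)"
  using assms by (auto simp: cgenideal_def)

lemma hom_add_pow_nat:
  assumes "x \<in> carrier R"
  shows "h ([(n::nat)] \<cdot> x) = [n] \<cdot>\<^bsub>S\<^esub> h x"
  by (induction n) (use assms in simp_all)

lemma coeff_map_closed:
  assumes f: "f \<in> carrier (UP R)"
  shows "coeff_map R h f \<in> carrier (UP S)"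
proof -
  interpret P: UP_cring R "UP R" by unfold_locales
  have "\<exists>n. bound \<zero>\<^bsub>S\<^esub> n (coeff_map R h f)"
    using f by (intro exI[of _ "deg R f"]) (auto simp: coeff_map_def P.deg_aboveD)
  then have "coeff_map R h f \<in> up S"
    using f by (intro mem_upI) (auto simp: coeff_map_def)
  then show ?thesis by (simp add: UP_def)
qed

lemma coeff_coeff_map:
  assumes "f \<in> carrier (UP R)"
  shows "coeff (UP S) (coeff_map R h f) n = h (coeff (UP R) f n)"
proof -
  have "coeff_map R h f \<in> up S"
    using coeff_map_closed[OF assms] by (simp add: UP_def)
  then show ?thesis by (simp add: UP_def[of S]) (simp add: coeff_map_def)
qed

lemma coeff_map_ring_hom_cring: "ring_hom_cring (UP R) (UP S) (coeff_map R h)"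
proof -
  interpret P: UP_cring R "UP R" by unfold_locales
  interpret Q: UP_cring S "UP S" by unfold_locales
  have "coeff_map R h \<in> ring_hom (UP R) (UP S)"
  proof (rule ring_hom_memI)
    fix f g assume fg: "f \<in> carrier (UP R)" "g \<in> carrier (UP R)"
    show "coeff_map R h (f \<otimes>\<^bsub>UP R\<^esub> g) = coeff_map R h f \<otimes>\<^bsub>UP S\<^esub> coeff_map R h g"
    proof (rule Q.up_eqI)
      fix n
      show "coeff (UP S) (coeff_map R h (f \<otimes>\<^bsub>UP R\<^esub> g)) n
          = coeff (UP S) (coeff_map R h f \<otimes>\<^bsub>UP S\<^esub> coeff_map R h g) n"
        using fg by (simp add: coeff_coeff_map coeff_map_closed Pi_def cong: S.finsum_cong)
    qed (use fg in \<open>auto simp: coeff_map_closed\<close>)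
    show "coeff_map R h (f \<oplus>\<^bsub>UP R\<^esub> g) = coeff_map R h f \<oplus>\<^bsub>UP S\<^esub> coeff_map R h g"
      using fg by (intro Q.up_eqI) (auto simp: coeff_coeff_map coeff_map_closed)
  next
    show "coeff_map R h \<one>\<^bsub>UP R\<^esub> = \<one>\<^bsub>UP S\<^esub>"
      by (intro Q.up_eqI) (auto simp: coeff_coeff_map coeff_map_closed)
  qed (simp add: coeff_map_closed)
  then show ?thesis
    by (intro ring_hom_cring.intro ring_hom_cring_axioms.intro P.P.is_cring Q.P.is_cring)
qed

lemma coeff_map_surj:
  assumes surj: "h ` carrier R = carrier S" and g: "g \<in> carrier (UP S)"
  obtains f where "f \<in> carrier (UP R)" "coeff_map R h f = g"
proof -
  interpret Q: UP_cring S "UP S" by unfold_locales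
  have "\<exists>r\<in>carrier R. h r = coeff (UP S) g i" for i
    using Q.coeff_closed[OF g, of i] surj by (metis imageE)
  then obtain r where r: "\<And>i. r i \<in> carrier R" "\<And>i. h (r i) = coeff (UP S) g i"
    by metis
  \<comment> \<open>A preimage of \<open>\<zero>\<close> need not be \<open>\<zero>\<close>, so the lift is cut off above the degree.\<close>
  define f where "f = (\<lambda>i. if i \<le> deg S g then r i else \<zero>)"
  have up: "f \<in> up R"
    using r by (intro mem_upI exI[of _ "deg S g"]) (auto simp: f_def)
  then have f: "f \<in> carrier (UP R)" and cf: "coeff (UP R) f i = f i" for i
    by (simp_all add: UP_def)
  have "coeff_map R h f = g"
  proof (rule Q.up_eqI)
    show "coeff (UP S) (coeff_map R h f) i = coeff (UP S) g i" for i
      using f g by (simp add: coeff_coeff_map cf) (simp add: f_def r Q.deg_aboveD)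
  qed (use f g in \<open>auto simp: coeff_map_closed\<close>)
  with f show ?thesis using that by blast
qed

end

lemma reduce_poly_eq_coeff_map: "reduce_poly R I = coeff_map R ((+>\<^bsub>R\<^esub>) I)"
  by (simp add: fun_eq_iff reduce_poly_def coeff_map_def)

section \<open>Quotients that are p-rings\<close>

lemma (in ideal) carrier_Quot: "carrier (R Quot I) = (+>) I ` carrier R"
  unfolding FactRing_def A_RCOSETS_def' by auto

lemma (in cring) p_ring_Quot_iff:
  assumes char: "\<And>x. x \<in> carrier R \<Longrightarrow> [p] \<cdot> x = \<zero>"
    and I: "ideal I R" "I \<noteq> carrier R"
  shows "p_ring p (R Quot I) \<longleftrightarrow> (\<forall>x\<in>carrier R. x [^] p \<ominus> x \<in> I)"
proof -
  interpret I: ideal I R by fact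
  interpret h: ring_hom_cring R "R Quot I" "(+>) I"
    by (rule I.rcos_ring_hom_cring) (rule is_cring)
  have eq: "I +> x = I +> y \<longleftrightarrow> x \<ominus> y \<in> I" if "x \<in> carrier R" "y \<in> carrier R" for x y
    using quotient_eq_iff_same_a_r_cos[OF I(1) that] by simp
  have carr: "carrier (R Quot I) = (+>) I ` carrier R"
    by (rule I.carrier_Quot)
  have pow: "(I +> x) [^]\<^bsub>R Quot I\<^esub> p = I +> x \<longleftrightarrow> x [^] p \<ominus> x \<in> I" if "x \<in> carrier R" for x
    using that eq[of "x [^] p" x] by simp
  have "\<one>\<^bsub>R Quot I\<^esub> \<noteq> \<zero>\<^bsub>R Quot I\<^esub>"
  proof
    assume "\<one>\<^bsub>R Quot I\<^esub> = \<zero>\<^bsub>R Quot I\<^esub>"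
    then have "I +> \<one> = I +> \<zero>" by (simp only: h.hom_one h.hom_zero)
    then have "\<one> \<ominus> \<zero> \<in> I" by (simp only: eq one_closed zero_closed)
    then have "\<one> \<in> I" by (simp add: a_minus_def)
    then show False using I(2) by (simp add: I.one_imp_carrier)
  qed
  moreover have "[p] \<cdot>\<^bsub>R Quot I\<^esub> (I +> x) = \<zero>\<^bsub>R Quot I\<^esub>" if x: "x \<in> carrier R" for x
    using h.hom_add_pow_nat[OF x, of p] h.hom_zero x by (simp only: char)
  ultimately show ?thesis
    unfolding p_ring_def p_ring_axioms_def carr using pow h.S.is_cring by auto
qed

lemma (in p_ring) p_ring_Quot:
  assumes I: "ideal I R" "I \<noteq> carrier R"
  shows "p_ring p (R Quot I)"
proof -
  have "\<zero> \<in> I" using I(1) by (rule additive_subgroup.zero_closed[OF ideal.axioms(1)])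
  then show ?thesis
    using p_ring_Quot_iff[OF add_pow_p I] by (simp add: pow_p a_minus_def r_neg)
qed

lemma (in p_ring) UP_char:
  assumes f: "f \<in> carrier (UP R)"
  shows "[p] \<cdot>\<^bsub>UP R\<^esub> f = \<zero>\<^bsub>UP R\<^esub>"
proof -
  interpret P: UP_cring R "UP R" by unfold_locales
  have "coeff (UP R) ([n] \<cdot>\<^bsub>UP R\<^esub> f) i = [n] \<cdot> coeff (UP R) f i" for n :: nat and i
    by (induction n) (use f in simp_all)
  then show ?thesis
    using f by (intro P.up_eqI) (auto simp: add_pow_p)
qed

section \<open>Split polynomials over a finite field\<close>

text \<open>
  Division of \<open>f\<close> by \<open>g\<close> leaves a remainder that still vanishes at the \<open>deg g\<close> roots of \<open>g\<close>, but has
  smaller degree.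
\<close>

lemma (in field) splits_distinct_dvd:
  assumes fin: "finite (carrier R)" and g: "g \<in> carrier (UP R)" and split: "splits_distinct R g"
    and f: "f \<in> carrier (UP R)" and roots: "poly_roots R g \<subseteq> poly_roots R f"
  shows "f \<in> PIdl\<^bsub>UP R\<^esub> g"
proof -
  interpret P: UP_domain R "UP R" by unfold_locales
  interpret E: UP_pre_univ_prop R R id "UP R" by unfold_locales simp
  have g0: "g \<noteq> \<zero>\<^bsub>UP R\<^esub>" and card: "card (poly_roots R g) = deg R g"
    using split by (auto simp: splits_distinct_def)
  define c where "c = coeff (UP R) g (deg R g)"
  have c: "c \<in> carrier R" "c \<noteq> \<zero>"
    using g g0 P.lcoeff_nonzero2 by (auto simp: c_def)
  obtain q r and k :: nat where q: "q \<in> carrier (UP R)" and r: "r \<in> carrier (UP R)"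
    and eq: "c [^] k \<odot>\<^bsub>UP R\<^esub> f = g \<otimes>\<^bsub>UP R\<^esub> q \<oplus>\<^bsub>UP R\<^esub> r"
    and deg: "r = \<zero>\<^bsub>UP R\<^esub> \<or> deg R r < deg R g"
    using P.long_div_theorem[OF g f g0] unfolding c_def by blast
  \<comment> \<open>Pseudo-division multiplies \<open>f\<close> by a power of the leading coefficient of \<open>g\<close>; in a field this
    power can be divided out at the end.\<close>
  have ck: "c [^] k \<in> Units R"
    using c by (intro Units_pow_closed) (simp add: field_Units)
  then have ckc: "c [^] k \<in> carrier R" by auto
  have sub: "poly_roots R g \<subseteq> poly_roots R r"
  proof
    fix a assume a: "a \<in> poly_roots R g"
    then have ac: "a \<in> carrier R" by (simp add: poly_roots_def)
    interpret V: ring_hom_cring "UP R" R "UnivPoly.eval R R id a"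
      by unfold_locales (rule E.eval_ring_hom[OF ac])
    have "UnivPoly.eval R R id a (monom (UP R) (c [^] k) 0 \<otimes>\<^bsub>UP R\<^esub> f)
        = UnivPoly.eval R R id a (g \<otimes>\<^bsub>UP R\<^esub> q \<oplus>\<^bsub>UP R\<^esub> r)"
      using eq ckc f by (simp add: P.monom_mult_is_smult)
    then show "a \<in> poly_roots R r"
      using a roots ckc f g q r by (auto simp: poly_roots_def)
  qed
  have "r = \<zero>\<^bsub>UP R\<^esub>"
  proof (rule ccontr)
    assume r0: "r \<noteq> \<zero>\<^bsub>UP R\<^esub>"
    have "deg R g \<le> card (poly_roots R r)"
      using card_mono[OF _ sub] fin card by (simp add: poly_roots_def)
    also have "\<dots> \<le> deg R r"
      using P.roots_bound[OF r r0 fin] by (simp add: poly_roots_def)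
    finally show False using deg r0 by simp
  qed
  then have "c [^] k \<odot>\<^bsub>UP R\<^esub> f = q \<otimes>\<^bsub>UP R\<^esub> g"
    using eq q g by (simp add: P.P.m_comm)
  then have "inv (c [^] k) \<odot>\<^bsub>UP R\<^esub> (c [^] k \<odot>\<^bsub>UP R\<^esub> f)
      = (inv (c [^] k) \<odot>\<^bsub>UP R\<^esub> q) \<otimes>\<^bsub>UP R\<^esub> g"
    using ck q g by (simp add: P.smult_assoc2)
  then have "f = (inv (c [^] k) \<odot>\<^bsub>UP R\<^esub> q) \<otimes>\<^bsub>UP R\<^esub> g"
    using ck ckc f by (simp add: P.smult_assoc1[symmetric])
  then show ?thesis
    using ck q by (auto simp: cgenideal_def)
qed

text \<open>The additive order of \<open>\<one>\<close> divides \<open>p\<close> and is not \<open>1\<close>, so it is \<open>p\<close>.\<close>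

lemma (in p_ring) p_le_card:
  assumes p: "Factorial_Ring.prime p" and fin: "finite (carrier R)"
  shows "p \<le> card (carrier R)"
proof -
  have "group.ord (add_monoid R) \<one> dvd p"
    using add_pow_p[OF one_closed] add.pow_eq_id[of \<one> p] by (simp add: add_pow_def)
  moreover have "group.ord (add_monoid R) \<one> \<noteq> 1"
    using add.ord_eq_1[of \<one>] one_neq_zero by simp
  ultimately have "group.ord (add_monoid R) \<one> = p"
    using p by (auto simp: prime_nat_iff)
  then show ?thesis
    using add.ord_le_group_order[of \<one>] fin by (simp add: order_def)
qed

text \<open>
  If \<open>x\<^sup>p - x = h f\<close>, every element of the field is a root of \<open>h\<close> or of \<open>f\<close>.  There are at least \<open>p\<close>
  elements, while \<open>h\<close> has at most \<open>deg h = p - deg f\<close> roots; so \<open>f\<close> has at least \<open>deg f\<close> of them.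
\<close>

lemma splits_distinct_if_dvd_X_pow_p_diff:
  assumes p: "Factorial_Ring.prime p" and K: "field K" "p_ring p K" and fin: "finite (carrier K)"
    and f: "f \<in> carrier (UP K)"
    and dvd: "monom (UP K) \<one>\<^bsub>K\<^esub> 1 [^]\<^bsub>UP K\<^esub> p \<ominus>\<^bsub>UP K\<^esub> monom (UP K) \<one>\<^bsub>K\<^esub> 1 \<in> PIdl\<^bsub>UP K\<^esub> f"
  shows "splits_distinct K f"
proof -
  interpret K: field K by fact
  interpret pK: p_ring p K by fact
  interpret P: UP_domain K "UP K" by unfold_locales
  interpret E: UP_pre_univ_prop K K id "UP K" by unfold_locales simp
  define F where "F = monom (UP K) \<one>\<^bsub>K\<^esub> 1 [^]\<^bsub>UP K\<^esub> p \<ominus>\<^bsub>UP K\<^esub> monom (UP K) \<one>\<^bsub>K\<^esub> 1"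
  have F: "F \<in> carrier (UP K)" by (simp add: F_def)
  have F_monom: "F = monom (UP K) \<one>\<^bsub>K\<^esub> p \<ominus>\<^bsub>UP K\<^esub> monom (UP K) \<one>\<^bsub>K\<^esub> 1"
    using P.monom_pow[of "\<one>\<^bsub>K\<^esub>" 1 p] by (simp add: F_def)
  have p1: "1 < p" using p by (rule prime_gt_1_nat)
  have degF: "deg K F = p"
    unfolding F_monom using p1 by (subst P.deg_minus_eq) auto
  obtain h where h: "h \<in> carrier (UP K)" and Fh: "F = h \<otimes>\<^bsub>UP K\<^esub> f"
    using dvd by (auto simp: F_def cgenideal_def)
  have F0: "F \<noteq> \<zero>\<^bsub>UP K\<^esub>" using degF p1 by auto
  then have nz: "h \<noteq> \<zero>\<^bsub>UP K\<^esub>" "f \<noteq> \<zero>\<^bsub>UP K\<^esub>" using Fh h f by auto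
  have degs: "deg K h + deg K f = p"
    using degF P.deg_mult[OF nz h f] Fh by simp
  have cover: "carrier K \<subseteq> poly_roots K h \<union> poly_roots K f"
  proof
    fix a assume a: "a \<in> carrier K"
    interpret V: ring_hom_cring "UP K" K "UnivPoly.eval K K id a"
      by unfold_locales (rule E.eval_ring_hom[OF a])
    have "UnivPoly.eval K K id a (monom (UP K) \<one>\<^bsub>K\<^esub> 1) = a"
      using a by (rule E.eval_monom1)
    then have "UnivPoly.eval K K id a F = a [^]\<^bsub>K\<^esub> p \<ominus>\<^bsub>K\<^esub> a"
      using a by (simp add: F_def a_minus_def)
    then have "UnivPoly.eval K K id a F = \<zero>\<^bsub>K\<^esub>"
      using a by (simp add: pK.pow_p K.r_right_minus_eq)
    then have "UnivPoly.eval K K id a h \<otimes>\<^bsub>K\<^esub> UnivPoly.eval K K id a f = \<zero>\<^bsub>K\<^esub>"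
      using Fh h f by simp
    then show "a \<in> poly_roots K h \<union> poly_roots K f"
      using a h f K.integral by (auto simp: poly_roots_def)
  qed
  have bounds: "card (poly_roots K h) \<le> deg K h" "card (poly_roots K f) \<le> deg K f"
    using P.roots_bound[OF h nz(1) fin] P.roots_bound[OF f nz(2) fin]
    by (simp_all add: poly_roots_def)
  have "p \<le> card (carrier K)" by (rule pK.p_le_card[OF p fin])
  also have "\<dots> \<le> card (poly_roots K h \<union> poly_roots K f)"
    using fin by (intro card_mono[OF _ cover]) (auto simp: poly_roots_def)
  also have "\<dots> \<le> card (poly_roots K h) + card (poly_roots K f)" by (rule card_Un_le)
  finally have "card (poly_roots K f) = deg K f"
    using bounds degs by linarith
  then show ?thesis using nz by (simp add: splits_distinct_def)
qed

lemma splits_distinct_iff_dvd_pow_p_diff: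
  assumes p: "Factorial_Ring.prime p" and K: "field K" "p_ring p K" and fin: "finite (carrier K)"
    and f: "f \<in> carrier (UP K)"
  shows "splits_distinct K f \<longleftrightarrow>
    (\<forall>g\<in>carrier (UP K). g [^]\<^bsub>UP K\<^esub> p \<ominus>\<^bsub>UP K\<^esub> g \<in> PIdl\<^bsub>UP K\<^esub> f)"
proof -
  interpret K: field K by fact
  interpret pK: p_ring p K by fact
  interpret P: UP_domain K "UP K" by unfold_locales
  interpret E: UP_pre_univ_prop K K id "UP K" by unfold_locales simp
  show ?thesis
  proof (intro iffI ballI)
    fix g assume split: "splits_distinct K f" and g: "g \<in> carrier (UP K)"
    show "g [^]\<^bsub>UP K\<^esub> p \<ominus>\<^bsub>UP K\<^esub> g \<in> PIdl\<^bsub>UP K\<^esub> f"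
    proof (rule K.splits_distinct_dvd[OF fin f split])
      \<comment> \<open>The values of \<open>g\<close> lie in \<open>K\<close>, where the \<open>p\<close>-th power map is the identity.\<close>
      have "UnivPoly.eval K K id a (g [^]\<^bsub>UP K\<^esub> p \<ominus>\<^bsub>UP K\<^esub> g) = \<zero>\<^bsub>K\<^esub>"
        if a: "a \<in> carrier K" for a
      proof -
        interpret V: ring_hom_cring "UP K" K "UnivPoly.eval K K id a"
          by unfold_locales (rule E.eval_ring_hom[OF a])
        show ?thesis using g by (simp add: a_minus_def pK.pow_p K.r_neg)
      qed
      then show "poly_roots K f \<subseteq> poly_roots K (g [^]\<^bsub>UP K\<^esub> p \<ominus>\<^bsub>UP K\<^esub> g)"
        by (auto simp: poly_roots_def)
    qed (use g in simp)
  next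
    assume dvd: "\<forall>g\<in>carrier (UP K). g [^]\<^bsub>UP K\<^esub> p \<ominus>\<^bsub>UP K\<^esub> g \<in> PIdl\<^bsub>UP K\<^esub> f"
    show "splits_distinct K f"
      by (rule splits_distinct_if_dvd_X_pow_p_diff[OF p K fin f bspec[OF dvd]]) simp
  qed
qed

section \<open>Divisibility of polynomials is a local property\<close>

lemma (in ring) maximalideal_above:
  assumes fin: "finite (carrier R)" and J: "ideal J R" "J \<noteq> carrier R"
  obtains M where "maximalideal M R" "J \<subseteq> M"
proof -
  define A where "A = {I. ideal I R \<and> J \<subseteq> I \<and> I \<noteq> carrier R}"
  have sub: "I \<subseteq> carrier R" if "ideal I R" for I
    using that by (rule additive_subgroup.a_subset[OF ideal.axioms(1)])
  have "finite A"
    by (rule finite_subset[of _ "Pow (carrier R)"]) (use sub fin in \<open>auto simp: A_def\<close>)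
  moreover have "J \<in> A" using J by (simp add: A_def)
  ultimately obtain M where M: "M \<in> A" "J \<subseteq> M" and max: "\<And>I. I \<in> A \<Longrightarrow> M \<subseteq> I \<Longrightarrow> M = I"
    using finite_has_maximal2[of A J] by metis
  have "maximalideal M R"
  proof (rule maximalidealI)
    fix I assume I: "ideal I R" "M \<subseteq> I"
    show "I = M \<or> I = carrier R"
      using M(2) I max[of I] by (auto simp: A_def)
  qed (use M(1) in \<open>auto simp: A_def\<close>)
  with M(2) show ?thesis using that by blast
qed

text \<open>
  In a \<open>p\<close>-ring \<open>c (1 - c\<^sup>p\<^sup>-\<^sup>1) = 0\<close>, and \<open>1 - c\<^sup>p\<^sup>-\<^sup>1 \<notin> M\<close> for \<open>c \<in> M\<close>.  The product of these factors
  over \<open>C\<close> stays outside \<open>M\<close> because \<open>M\<close> is prime.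
\<close>

lemma (in p_ring) annihilator_outside_prime:
  assumes p: "Factorial_Ring.prime p" and M: "primeideal M R" and C: "finite C" "C \<subseteq> M"
  obtains e where "e \<in> carrier R" "e \<notin> M" "\<And>c. c \<in> C \<Longrightarrow> e \<otimes> c = \<zero>"
proof -
  interpret M: primeideal M R by fact
  have "\<exists>e\<in>carrier R. e \<notin> M \<and> (\<forall>c\<in>C. e \<otimes> c = \<zero>)"
    using C
  proof (induction C)
    case empty
    have "\<one> \<notin> M" using M.I_notcarr M.one_imp_carrier by auto
    then show ?case by auto
  next
    case (insert c C)
    then obtain e where e: "e \<in> carrier R" "e \<notin> M" "\<And>x. x \<in> C \<Longrightarrow> e \<otimes> x = \<zero>" by auto
    have cM: "c \<in> M" and c: "c \<in> carrier R" using insert.prems M.a_subset by auto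
    have CR: "C \<subseteq> carrier R" using insert.prems M.a_subset by auto
    \<comment> \<open>\<open>p - 1 = Suc k\<close> is positive, so that \<open>c\<^sup>p\<^sup>-\<^sup>1\<close> lies in \<open>M\<close>.\<close>
    obtain k where k: "p = Suc (Suc k)"
      using prime_gt_1_nat[OF p] by (metis Suc_lessD gr0_implies_Suc less_not_refl One_nat_def not0_implies_Suc)
    define d where "d = c [^] Suc k"
    have d: "d \<in> carrier R" "d \<in> M" and dc: "d \<otimes> c = c"
      using c cM pow_p[OF c] by (auto simp: d_def k intro: M.I_l_closed)
    have "\<one> \<ominus> d \<notin> M"
    proof
      assume "\<one> \<ominus> d \<in> M"
      then have "(\<one> \<ominus> d) \<oplus> d \<in> M" using d by auto
      moreover have "(\<one> \<ominus> d) \<oplus> d = \<one>" using d by algebra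
      ultimately show False using M.I_notcarr M.one_imp_carrier by auto
    qed
    then have "e \<otimes> (\<one> \<ominus> d) \<notin> M" using M.I_prime e d by blast
    moreover have "e \<otimes> (\<one> \<ominus> d) \<otimes> c = \<zero>"
    proof -
      have "e \<otimes> (\<one> \<ominus> d) \<otimes> c = e \<otimes> (c \<ominus> d \<otimes> c)" using e d c by algebra
      then show ?thesis using dc e c by (simp add: a_minus_def r_neg)
    qed
    moreover have "e \<otimes> (\<one> \<ominus> d) \<otimes> x = \<zero>" if x: "x \<in> C" for x
    proof -
      have xc: "x \<in> carrier R" using x CR by auto
      have "e \<otimes> (\<one> \<ominus> d) \<otimes> x = (\<one> \<ominus> d) \<otimes> (e \<otimes> x)" using e d xc by algebra
      then show ?thesis using e(3)[OF x] d by simp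
    qed
    ultimately show ?case using e d by (intro bexI[of _ "e \<otimes> (\<one> \<ominus> d)"]) auto
  qed
  then show ?thesis using that by blast
qed

text \<open>
  Multiplying by the annihilator above turns divisibility modulo \<open>M\<close> into divisibility over \<open>R\<close> at
  the price of a factor outside \<open>M\<close>.  The possible factors form an ideal \<open>J\<close>; as \<open>J\<close> lies in no
  maximal ideal, it contains \<open>\<one>\<close>.
\<close>

lemma (in p_ring) dvd_locally_imp_dvd:
  assumes p: "Factorial_Ring.prime p" and fin: "finite (carrier R)"
    and f: "f \<in> carrier (UP R)" and g: "g \<in> carrier (UP R)"
    and loc: "\<And>M. maximalideal M R \<Longrightarrow>
      reduce_poly R M g \<in> PIdl\<^bsub>UP (R Quot M)\<^esub> (reduce_poly R M f)"
  shows "g \<in> PIdl\<^bsub>UP R\<^esub> f"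
proof -
  interpret P: UP_cring R "UP R" by unfold_locales
  interpret F: ideal "PIdl\<^bsub>UP R\<^esub> f" "UP R" using f by (rule P.P.cgenideal_ideal)
  define J where "J = {r \<in> carrier R. monom (UP R) r 0 \<otimes>\<^bsub>UP R\<^esub> g \<in> PIdl\<^bsub>UP R\<^esub> f}"
  have "ideal J R"
  proof (rule idealI)
    show "subgroup J (add_monoid R)"
    proof
      fix x y assume "x \<in> J" "y \<in> J"
      then show "x \<otimes>\<^bsub>add_monoid R\<^esub> y \<in> J"
        using g by (auto simp: J_def P.P.l_distr)
    next
      fix x assume x: "x \<in> J"
      then show "inv\<^bsub>add_monoid R\<^esub> x \<in> J"
        using g by (auto simp: J_def P.P.l_minus a_inv_def[symmetric])
    qed (use g in \<open>auto simp: J_def\<close>)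
    fix a x assume ax: "a \<in> J" "x \<in> carrier R"
    then have a: "a \<in> carrier R" by (simp add: J_def)
    have "monom (UP R) (x \<otimes> a) 0 \<otimes>\<^bsub>UP R\<^esub> g
        = monom (UP R) x 0 \<otimes>\<^bsub>UP R\<^esub> (monom (UP R) a 0 \<otimes>\<^bsub>UP R\<^esub> g)"
      using a ax g P.monom_mult[of x a 0 0] by (simp add: P.P.m_assoc)
    then show "x \<otimes> a \<in> J"
      using ax a by (auto simp: J_def intro: F.I_l_closed)
    then show "a \<otimes> x \<in> J" using a ax by (simp add: m_comm)
  qed (rule ring_axioms)
  have "J = carrier R"
  proof (rule ccontr)
    assume "J \<noteq> carrier R"
    then obtain M where max: "maximalideal M R" and JM: "J \<subseteq> M"
      using maximalideal_above[OF fin \<open>ideal J R\<close>] by blast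
    interpret M: maximalideal M R by fact
    have prime: "primeideal M R" using max by (rule maximalideal_prime)
    interpret q: ring_hom_cring R "R Quot M" "(+>) M"
      by (rule M.rcos_ring_hom_cring) (rule is_cring)
    interpret h: ring_hom_cring "UP R" "UP (R Quot M)" "coeff_map R ((+>) M)"
      by (rule q.coeff_map_ring_hom_cring)
    obtain u' where u': "u' \<in> carrier (UP (R Quot M))"
      and eq': "coeff_map R ((+>) M) g = u' \<otimes>\<^bsub>UP (R Quot M)\<^esub> coeff_map R ((+>) M) f"
      using loc[OF max] by (auto simp: cgenideal_def reduce_poly_eq_coeff_map)
    have surj: "(+>) M ` carrier R = carrier (R Quot M)"
      by (rule M.carrier_Quot[symmetric])
    obtain u where u: "u \<in> carrier (UP R)" and "coeff_map R ((+>) M) u = u'"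
      using q.coeff_map_surj[OF surj u'] by blast
    then have red: "coeff_map R ((+>) M) g = coeff_map R ((+>) M) (u \<otimes>\<^bsub>UP R\<^esub> f)"
      using eq' f by simp
    define d where "d = g \<ominus>\<^bsub>UP R\<^esub> u \<otimes>\<^bsub>UP R\<^esub> f"
    have d: "d \<in> carrier (UP R)" using f g u by (simp add: d_def)
    have coeff_M: "coeff (UP R) d i \<in> M" for i
    proof -
      have "M +> coeff (UP R) g i = M +> coeff (UP R) (u \<otimes>\<^bsub>UP R\<^esub> f) i"
        using fun_cong[OF red, of i] by (simp add: coeff_map_def)
      then have "coeff (UP R) g i \<ominus> coeff (UP R) (u \<otimes>\<^bsub>UP R\<^esub> f) i \<in> M"
        using quotient_eq_iff_same_a_r_cos[OF M.is_ideal] f g u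
        by (metis P.P.m_closed P.coeff_closed)
      then show ?thesis
        using f g u by (simp only: d_def P.coeff_minus P.P.m_closed)
    qed
    have "finite (range (coeff (UP R) d))"
      by (rule finite_subset[OF _ fin]) (use d in auto)
    then obtain e where e: "e \<in> carrier R" "e \<notin> M" and ann: "\<And>i. e \<otimes> coeff (UP R) d i = \<zero>"
      using annihilator_outside_prime[OF p prime, of "range (coeff (UP R) d)"] coeff_M
      by (metis image_subset_iff rangeI)
    have "e \<odot>\<^bsub>UP R\<^esub> d = \<zero>\<^bsub>UP R\<^esub>"
      using e d ann by (intro P.up_eqI) auto
    then have "monom (UP R) e 0 \<otimes>\<^bsub>UP R\<^esub> d = \<zero>\<^bsub>UP R\<^esub>"
      using e d by (simp add: P.monom_mult_is_smult)
    moreover have "g = d \<oplus>\<^bsub>UP R\<^esub> u \<otimes>\<^bsub>UP R\<^esub> f"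
      unfolding d_def using f g u by algebra
    ultimately have "monom (UP R) e 0 \<otimes>\<^bsub>UP R\<^esub> g = (monom (UP R) e 0 \<otimes>\<^bsub>UP R\<^esub> u) \<otimes>\<^bsub>UP R\<^esub> f"
      using e d u f by (metis P.P.l_zero P.P.m_assoc P.P.m_closed P.P.r_distr P.monom_closed)
    moreover have "(monom (UP R) e 0 \<otimes>\<^bsub>UP R\<^esub> u) \<otimes>\<^bsub>UP R\<^esub> f \<in> PIdl\<^bsub>UP R\<^esub> f"
      using F.I_l_closed[OF P.P.cgenideal_self[OF f]] e u by simp
    ultimately have "e \<in> J" using e by (simp add: J_def)
    with e JM show False by auto
  qed
  then have "\<one> \<in> J" by simp
  then show ?thesis using g by (simp add: J_def)
qed

section \<open>The criterion\<close>

theorem theorem2p8: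
  fixes p n :: nat and R (structure) and m :: "nat \<Rightarrow> 'a set" and f :: "nat \<Rightarrow> 'a"
  assumes "Factorial_Ring.prime p"
    and "p_ring p R"
    and "finite (carrier R)"
    and "bij_betw m {1..n} {I. maximalideal I R}"
    and "f \<in> carrier (UP R)"
    and "PIdl\<^bsub>UP R\<^esub> f \<noteq> carrier (UP R)"
  shows "p_ring p (UP R Quot (PIdl\<^bsub>UP R\<^esub> f)) \<longleftrightarrow>
    (\<forall>j\<in>{1..n}. splits_distinct (R Quot m j) (reduce_poly R (m j) f))"
proof -
  note p = assms(1) and fin = assms(3) and f = assms(5)
  interpret p_ring p R by fact
  interpret P: UP_cring R "UP R" by unfold_locales
  have local: "splits_distinct (R Quot M) (reduce_poly R M f) \<longleftrightarrow> (\<forall>g\<in>carrier (UP R).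
      reduce_poly R M (g [^]\<^bsub>UP R\<^esub> p \<ominus>\<^bsub>UP R\<^esub> g) \<in> PIdl\<^bsub>UP (R Quot M)\<^esub> (reduce_poly R M f))"
    if max: "maximalideal M R" for M
  proof -
    interpret M: maximalideal M R by fact
    let ?K = "R Quot M" and ?red = "coeff_map R ((+>) M)"
    interpret q: ring_hom_cring R ?K "(+>) M"
      by (rule M.rcos_ring_hom_cring) (rule is_cring)
    interpret h: ring_hom_cring "UP R" "UP ?K" ?red
      by (rule q.coeff_map_ring_hom_cring)
    have K: "field ?K" by (rule M.quotient_is_field) (rule is_cring)
    have pK: "p_ring p ?K" by (rule p_ring_Quot[OF M.is_ideal M.I_notcarr[symmetric]])
    have finK: "finite (carrier ?K)" using fin by (simp add: M.carrier_Quot)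
    have onto: "carrier (UP ?K) = ?red ` carrier (UP R)"
    proof
      show "carrier (UP ?K) \<subseteq> ?red ` carrier (UP R)"
        using q.coeff_map_surj[OF M.carrier_Quot[symmetric]] by (metis imageI subsetI)
    qed (simp add: image_subsetI)
    have "splits_distinct ?K (?red f) \<longleftrightarrow> (\<forall>G\<in>carrier (UP ?K).
        G [^]\<^bsub>UP ?K\<^esub> p \<ominus>\<^bsub>UP ?K\<^esub> G \<in> PIdl\<^bsub>UP ?K\<^esub> (?red f))"
      using f by (intro splits_distinct_iff_dvd_pow_p_diff[OF p K pK finK]) simp
    also have "\<dots> \<longleftrightarrow> (\<forall>g\<in>carrier (UP R).
        ?red (g [^]\<^bsub>UP R\<^esub> p \<ominus>\<^bsub>UP R\<^esub> g) \<in> PIdl\<^bsub>UP ?K\<^esub> (?red f))"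
      unfolding onto by (simp add: a_minus_def)
    finally show ?thesis by (simp only: reduce_poly_eq_coeff_map)
  qed
  have dvd_iff: "g \<in> PIdl\<^bsub>UP R\<^esub> f \<longleftrightarrow> (\<forall>M. maximalideal M R \<longrightarrow>
      reduce_poly R M g \<in> PIdl\<^bsub>UP (R Quot M)\<^esub> (reduce_poly R M f))"
    if g: "g \<in> carrier (UP R)" for g
  proof (intro iffI allI impI)
    fix M assume dvd: "g \<in> PIdl\<^bsub>UP R\<^esub> f" and max: "maximalideal M R"
    interpret M: maximalideal M R by fact
    interpret q: ring_hom_cring R "R Quot M" "(+>) M"
      by (rule M.rcos_ring_hom_cring) (rule is_cring)
    show "reduce_poly R M g \<in> PIdl\<^bsub>UP (R Quot M)\<^esub> (reduce_poly R M f)"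
      unfolding reduce_poly_eq_coeff_map
      by (rule ring_hom_cring.hom_cgenideal[OF q.coeff_map_ring_hom_cring f dvd])
  qed (simp add: dvd_locally_imp_dvd[OF p fin f g])
  have "p_ring p (UP R Quot (PIdl\<^bsub>UP R\<^esub> f)) \<longleftrightarrow>
      (\<forall>g\<in>carrier (UP R). g [^]\<^bsub>UP R\<^esub> p \<ominus>\<^bsub>UP R\<^esub> g \<in> PIdl\<^bsub>UP R\<^esub> f)"
    by (rule P.P.p_ring_Quot_iff[OF UP_char P.P.cgenideal_ideal[OF f] assms(6)])
  also have "\<dots> \<longleftrightarrow> (\<forall>g\<in>carrier (UP R). \<forall>M. maximalideal M R \<longrightarrow>
      reduce_poly R M (g [^]\<^bsub>UP R\<^esub> p \<ominus>\<^bsub>UP R\<^esub> g) \<in> PIdl\<^bsub>UP (R Quot M)\<^esub> (reduce_poly R M f))"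
    by (simp add: dvd_iff)
  also have "\<dots> \<longleftrightarrow> (\<forall>M. maximalideal M R \<longrightarrow> splits_distinct (R Quot M) (reduce_poly R M f))"
    using local by metis
  also have "\<dots> \<longleftrightarrow> (\<forall>M\<in>m ` {1..n}. splits_distinct (R Quot M) (reduce_poly R M f))"
    unfolding bij_betw_imp_surj_on[OF assms(4)] by simp
  finally show ?thesis by (simp only: ball_simps)
qed

end
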